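(* Let $S$ be a commutative semiring satisfying the finite-type $g$-closure hypothesis. Then the set $\mathrm{Id}_g(S)$ of $g$-closed ideals of $S$, ordered by inclusion, is a coherent frame. Consequently the space $\mathrm{Spec}_g(S)$ of $g$-prime ideals is spectral. Moreover, the space $\mathsf{CSpec}_g(S)$ of canonical prime $g$-congruences is homeomorphic to $\mathrm{Spec}_g(S)$.
   Context: A semiring here is commutative with $0$ and $1$: $(S,+,0)$ and $(S,\cdot,1)$ are commutative monoids, multiplication distributes over addition, and $0s=0$. An ideal is a non-empty subset closed under addition and under multiplication by arbitrary elements of $S$; $\mathrm{Id}(S)$ is the set of all ideals. A congruence is an equivalence relation on $S$ compatible with $+$ and $\cdot$; it is proper if it is not $S\times S$; maximal congruences are maximal among proper congruences, and $\mathrm{MaxCong}(S)$ is the set of these. The zero-class of a congruence $\theta$ is $0_\theta=\{a\in S\mid (a,0)\in\theta\}$. For an ideal $I$ put $\mathcal M_{\mathcal C}(I)=\{\theta\in\mathrm{MaxCong}(S)\mid I\subseteq 0_\theta\}$ and $\wp_I=\bigcap_{\theta\in\mathcal M_{\mathcal C}(I)}\theta$ (the empty intersection is $S\times S$). The canonical $g$-closure of $I$ is $g(I)=I^g=0_{\wp_I}$; this is a closure operation on $\mathrm{Id}(S)$. $I$ is $g$-closed if $I=I^g$, and $\mathrm{Id}_g(S)$ is the set of $g$-closed ideals. Write $\langle a\rangle_g=(\langle a\rangle)^g$ where $\langle a\rangle$ is the principal ideal, and $I\vee_g J=(I+J)^g$. $S$ satisfies the finite-type $g$-closure hypothesis if: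 (G1) the closure $g:\mathrm{Id}(S)\to\mathrm{Id}(S)$ is of finite type (each element of $I^g$ lies in $F^g$ for some finitely generated ideal $F\subseteq I$); (G2) the fixed points of $g$ form a frame with meet given by intersection and join given by $g$ applied to sums; (G3) the compact elements of this fixed-point frame are exactly the finite $g$-joins $\langle a_1\rangle_g\vee_g\cdots\vee_g\langle a_n\rangle_g$; (G4) $\langle a\rangle_g\cap\langle b\rangle_g=\langle ab\rangle_g$ for all $a,b\in S$, and hence finite $g$-joins of principal $g$-closures are closed under finite meets. A proper $g$-closed ideal $P$ is $g$-prime if $AB\subseteq P$ implies $A\subseteq P$ or $B\subseteq P$ for all $A,B\in\mathrm{Id}_g(S)$. $\mathrm{Spec}_g(S)$ is the set of $g$-prime ideals, with closed sets $\{P\in\mathrm{Spec}_g(S)\mid A\subseteq P\}$, $A\subseteq S$. A canonical $g$-congruence is a congruence of the form $\wp_I$ with $I$ a $g$-closed ideal; a proper canonical $g$-congruence $\rho$ is prime if $(ab,0)\in\rho$ implies $(a,0)\in\rho$ or $(b,0)\in\rho$. $\mathsf{CSpec}_g(S)$ is the set of canonical prime $g$-congruences, with closed sets $\{\rho\in\mathsf{CSpec}_g(S)\mid A\subseteq 0_\rho\}$, $A\subseteq S$. A frame is a complete lattice in which finite meets distribute over arbitrary joins. An element $c$ is compact if $c\leqslant\bigvee A$ implies $c\leqslant\bigvee A_0$ for some finite $A_0\subseteq A$. A frame is coherent if its top element is compact, every element is a join of compact elements, and compact elements are closed under finite meets. A space is spectral if it is quasi-compact and sober and has a basis of quasi-compact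 open sets closed under finite intersections. *)

theory Defs
  imports
    "HOL-Analysis.Abstract_Topology"
    "HOL-Algebra.Complete_Lattice"
    "HOL-Library.Set_Algebras"
begin

section \<open>Frames and coherent frames\<close>

definition frame :: "('a, 'b) gorder_scheme \<Rightarrow> bool" where
  "frame L \<longleftrightarrow> complete_lattice L \<and>
     (\<forall>x \<in> carrier L. \<forall>A \<subseteq> carrier L.
        x \<sqinter>\<^bsub>L\<^esub> (\<Squnion>\<^bsub>L\<^esub> A) = \<Squnion>\<^bsub>L\<^esub> ((\<lambda>a. x \<sqinter>\<^bsub>L\<^esub> a) ` A))"

definition compact_elements :: "('a, 'b) gorder_scheme \<Rightarrow> 'a set" where
  "compact_elements L =
     {c \<in> carrier L. \<forall>A \<subseteq> carrier L. c \<sqsubseteq>\<^bsub>L\<^esub> \<Squnion>\<^bsub>L\<^esub> A \<longrightarrow>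
        (\<exists>A0 \<subseteq> A. finite A0 \<and> c \<sqsubseteq>\<^bsub>L\<^esub> \<Squnion>\<^bsub>L\<^esub> A0)}"

definition coherent_frame :: "('a, 'b) gorder_scheme \<Rightarrow> bool" where
  "coherent_frame L \<longleftrightarrow> frame L \<and>
     \<top>\<^bsub>L\<^esub> \<in> compact_elements L \<and>
     (\<forall>x \<in> carrier L. \<exists>A \<subseteq> compact_elements L. x = \<Squnion>\<^bsub>L\<^esub> A) \<and>
     (\<forall>F \<subseteq> compact_elements L. finite F \<longrightarrow> \<Sqinter>\<^bsub>L\<^esub> F \<in> compact_elements L)"

section \<open>Spectral spaces\<close>

definition irreducible_closedin :: "'a topology \<Rightarrow> 'a set \<Rightarrow> bool" where
  "irreducible_closedin X C \<longleftrightarrow> closedin X C \<and> C \<noteq> {} \<and>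
     (\<forall>D E. closedin X D \<and> closedin X E \<and> C = D \<union> E \<longrightarrow> C = D \<or> C = E)"

definition sober_space :: "'a topology \<Rightarrow> bool" where
  "sober_space X \<longleftrightarrow>
     (\<forall>C. irreducible_closedin X C \<longrightarrow> (\<exists>!x. x \<in> topspace X \<and> X closure_of {x} = C))"

text \<open>The empty intersection of basic open sets is read as the whole space.\<close>

definition spectral_space :: "'a topology \<Rightarrow> bool" where
  "spectral_space X \<longleftrightarrow> compact_space X \<and> sober_space X \<and>
     (\<exists>B. (\<forall>U \<in> B. openin X U \<and> compactin X U) \<and>
          openin X = arbitrary union_of (\<lambda>U. U \<in> B) \<and>
          (\<forall>F \<subseteq> B. finite F \<longrightarrow> topspace X \<inter> \<Inter>F \<in> B))"

section \<open>Ideals and congruences of commutative semirings\<close>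

text \<open>
  The semiring is the whole type \<^typ>\<open>'a\<close>. The sort \<open>{comm_semiring_0, comm_monoid_mult}\<close> is
  that of \<^class>\<open>comm_semiring_1\<close> without the axiom \<open>0 \<noteq> 1\<close>, so that the trivial semiring is
  included.
\<close>

definition semiring_ideal :: "'a::{comm_semiring_0, comm_monoid_mult} set \<Rightarrow> bool" where
  "semiring_ideal I \<longleftrightarrow> I \<noteq> {} \<and> (\<forall>x \<in> I. \<forall>y \<in> I. x + y \<in> I) \<and> (\<forall>s. \<forall>x \<in> I. s * x \<in> I)"

definition principal_ideal :: "'a::{comm_semiring_0, comm_monoid_mult} \<Rightarrow> 'a set" where
  "principal_ideal a = semiring_ideal hull {a}"

text \<open>
  Addition, finite sums and multiplication of sets are the elementwise ones, so the sum of a family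
  of ideals consists of the finite sums of elements of its members, while the product of ideals has
  to be generated by the elementwise product.
\<close>

definition ideal_Sum :: "'a::{comm_semiring_0, comm_monoid_mult} set set \<Rightarrow> 'a set" where
  "ideal_Sum \<I> = (\<Union>F \<in> {F. finite F \<and> F \<subseteq> \<I>}. \<Sum>I\<in>F. I)"

definition ideal_mult ::
  "'a::{comm_semiring_0, comm_monoid_mult} set \<Rightarrow> 'a set \<Rightarrow> 'a set" where
  "ideal_mult A B = semiring_ideal hull (A * B)"

definition congruence :: "'a::{comm_semiring_0, comm_monoid_mult} rel \<Rightarrow> bool" where
  "congruence \<theta> \<longleftrightarrow> equiv UNIV \<theta> \<and>
     (\<forall>a b c d. (a, b) \<in> \<theta> \<longrightarrow> (c, d) \<in> \<theta> \<longrightarrow> (a + c, b + d) \<in> \<theta> \<and> (a * c, b * d) \<in> \<theta>)"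

definition MaxCong :: "'a::{comm_semiring_0, comm_monoid_mult} rel set" where
  "MaxCong = {\<theta>. congruence \<theta> \<and> \<theta> \<noteq> UNIV \<and>
     (\<forall>\<phi>. congruence \<phi> \<longrightarrow> \<phi> \<noteq> UNIV \<longrightarrow> \<theta> \<subseteq> \<phi> \<longrightarrow> \<phi> = \<theta>)}"

definition cong_zero_class :: "'a::{comm_semiring_0, comm_monoid_mult} rel \<Rightarrow> 'a set" where
  "cong_zero_class \<theta> = {a. (a, 0) \<in> \<theta>}"

section \<open>The canonical closure\<close>

definition max_congs_over :: "'a::{comm_semiring_0, comm_monoid_mult} set \<Rightarrow> 'a rel set" where
  "max_congs_over I = {\<theta> \<in> MaxCong. I \<subseteq> cong_zero_class \<theta>}"

definition canonical_cong :: "'a::{comm_semiring_0, comm_monoid_mult} set \<Rightarrow> 'a rel" where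
  "canonical_cong I = \<Inter>(max_congs_over I)"

definition g_closure :: "'a::{comm_semiring_0, comm_monoid_mult} set \<Rightarrow> 'a set" where
  "g_closure I = cong_zero_class (canonical_cong I)"

definition Id_g :: "'a::{comm_semiring_0, comm_monoid_mult} set set" where
  "Id_g = {I. semiring_ideal I \<and> g_closure I = I}"

definition Id_g_order :: "'a::{comm_semiring_0, comm_monoid_mult} set gorder" where
  "Id_g_order = \<lparr>carrier = Id_g, eq = (=), le = (\<subseteq>)\<rparr>"

definition g_principal :: "'a::{comm_semiring_0, comm_monoid_mult} \<Rightarrow> 'a set" where
  "g_principal a = g_closure (principal_ideal a)"

definition g_join :: "'a::{comm_semiring_0, comm_monoid_mult} set \<Rightarrow> 'a set \<Rightarrow> 'a set" where
  "g_join I J = g_closure (I + J)"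

definition finite_g_joins :: "'a::{comm_semiring_0, comm_monoid_mult} set set" where
  "finite_g_joins = {foldl g_join (g_principal a) (map g_principal as) | a as. True}"

text \<open>
  The closure of finitely generated \<open>g\<close>-closed ideals under finite meets is not listed, since it
  follows from the second and the last condition.
\<close>

definition finite_type_g_closure :: "'a::{comm_semiring_0, comm_monoid_mult} itself \<Rightarrow> bool" where
  "finite_type_g_closure _ \<longleftrightarrow>
     (\<forall>I :: 'a set. semiring_ideal I \<longrightarrow>
        (\<forall>x \<in> g_closure I. \<exists>X. finite X \<and> semiring_ideal hull X \<subseteq> I \<and>
           x \<in> g_closure (semiring_ideal hull X))) \<and>
     (frame (Id_g_order :: 'a set gorder) \<and>
        (\<forall>\<I> \<subseteq> (Id_g :: 'a set set).
           \<Sqinter>\<^bsub>Id_g_order\<^esub> \<I> = \<Inter>\<I> \<and> \<Squnion>\<^bsub>Id_g_order\<^esub> \<I> = g_closure (ideal_Sum \<I>))) \<and>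
     compact_elements (Id_g_order :: 'a set gorder) = finite_g_joins \<and>
     (\<forall>a b :: 'a. g_principal a \<inter> g_principal b = g_principal (a * b))"

section \<open>The two spectra\<close>

definition Spec_g :: "'a::{comm_semiring_0, comm_monoid_mult} set set" where
  "Spec_g = {P \<in> Id_g. P \<noteq> UNIV \<and>
     (\<forall>A \<in> Id_g. \<forall>B \<in> Id_g. ideal_mult A B \<subseteq> P \<longrightarrow> A \<subseteq> P \<or> B \<subseteq> P)}"

definition CSpec_g :: "'a::{comm_semiring_0, comm_monoid_mult} rel set" where
  "CSpec_g = {\<rho>. (\<exists>I \<in> Id_g. \<rho> = canonical_cong I) \<and> \<rho> \<noteq> UNIV \<and>
     (\<forall>a b. (a * b, 0) \<in> \<rho> \<longrightarrow> (a, 0) \<in> \<rho> \<or> (b, 0) \<in> \<rho>)}"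

definition Spec_g_space :: "'a::{comm_semiring_0, comm_monoid_mult} set topology" where
  "Spec_g_space = topology (\<lambda>U. \<exists>A. U = Spec_g - {P \<in> Spec_g. A \<subseteq> P})"

definition CSpec_g_space :: "'a::{comm_semiring_0, comm_monoid_mult} rel topology" where
  "CSpec_g_space = topology (\<lambda>U. \<exists>A. U = CSpec_g - {\<rho> \<in> CSpec_g. A \<subseteq> cong_zero_class \<rho>})"

text \<open>
  The operator \<^const>\<open>topology\<close> is only meaningful if its argument satisfies \<^const>\<open>istopology\<close>.
  The rest of this theory checks that for the two spaces, with no assumption on the semiring.
\<close>

lemma istopology_zariski:
  fixes Z :: "'p \<Rightarrow> 'a::times set"
  assumes prime: "\<And>x a b. x \<in> X \<Longrightarrow> a * b \<in> Z x \<longleftrightarrow> a \<in> Z x \<or> b \<in> Z x"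
  shows "istopology (\<lambda>U. \<exists>A. U = X - {x \<in> X. A \<subseteq> Z x})"
  unfolding istopology_def
proof (intro conjI allI impI)
  fix U V
  assume "\<exists>A. U = X - {x \<in> X. A \<subseteq> Z x}" "\<exists>A. V = X - {x \<in> X. A \<subseteq> Z x}"
  then obtain A B where AB: "U = X - {x \<in> X. A \<subseteq> Z x}" "V = X - {x \<in> X. B \<subseteq> Z x}"
    by blast
  have "A * B \<subseteq> Z x \<longleftrightarrow> A \<subseteq> Z x \<or> B \<subseteq> Z x" if "x \<in> X" for x
    unfolding set_times_def using prime[OF that] by blast
  then have "U \<inter> V = X - {x \<in> X. A * B \<subseteq> Z x}"
    unfolding AB by blast
  then show "\<exists>A. U \<inter> V = X - {x \<in> X. A \<subseteq> Z x}" by blast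
next
  fix \<K>
  assume "\<forall>K\<in>\<K>. \<exists>A. K = X - {x \<in> X. A \<subseteq> Z x}"
  then obtain f where f: "\<And>K. K \<in> \<K> \<Longrightarrow> K = X - {x \<in> X. f K \<subseteq> Z x}" by metis
  have "\<Union>\<K> = X - {x \<in> X. \<Union>(f ` \<K>) \<subseteq> Z x}"
    using f by blast
  then show "\<exists>A. \<Union>\<K> = X - {x \<in> X. A \<subseteq> Z x}" by blast
qed

lemma closedin_zariski:
  assumes T: "T = topology (\<lambda>U. \<exists>A. U = X - {x \<in> X. A \<subseteq> Z x})"
    and top: "istopology (\<lambda>U. \<exists>A. U = X - {x \<in> X. A \<subseteq> Z x})"
    and proper: "\<And>x. x \<in> X \<Longrightarrow> Z x \<noteq> UNIV"
  shows "topspace T = X" and "closedin T C \<longleftrightarrow> (\<exists>A. C = {x \<in> X. A \<subseteq> Z x})"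
proof -
  have opn: "openin T U \<longleftrightarrow> (\<exists>A. U = X - {x \<in> X. A \<subseteq> Z x})" for U
    unfolding T topology_inverse'[OF top] ..
  have "X = X - {x \<in> X. UNIV \<subseteq> Z x}"
    using proper by blast
  then have "openin T X"
    unfolding opn by blast
  then show ts: "topspace T = X"
    unfolding topspace_def using opn by blast
  show "closedin T C \<longleftrightarrow> (\<exists>A. C = {x \<in> X. A \<subseteq> Z x})"
    unfolding closedin_def ts opn by blast
qed

lemma congruenceD:
  assumes "congruence \<theta>"
  shows "(a, a) \<in> \<theta>" and "(a, b) \<in> \<theta> \<Longrightarrow> (b, a) \<in> \<theta>"
    and "(a, b) \<in> \<theta> \<Longrightarrow> (b, c) \<in> \<theta> \<Longrightarrow> (a, c) \<in> \<theta>"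
    and "(a, b) \<in> \<theta> \<Longrightarrow> (c, d) \<in> \<theta> \<Longrightarrow> (a + c, b + d) \<in> \<theta>"
    and "(a, b) \<in> \<theta> \<Longrightarrow> (c, d) \<in> \<theta> \<Longrightarrow> (a * c, b * d) \<in> \<theta>"
  using assms unfolding congruence_def equiv_def
  by (auto dest: refl_onD symD transD)

lemma zero_class_ideal:
  assumes "congruence \<theta>"
  shows "semiring_ideal (cong_zero_class \<theta>)"
  unfolding semiring_ideal_def cong_zero_class_def
proof (intro conjI allI ballI)
  show "{a. (a, 0) \<in> \<theta>} \<noteq> {}"
    using congruenceD(1)[OF assms] by blast
  show "x + y \<in> {a. (a, 0) \<in> \<theta>}" if "x \<in> {a. (a, 0) \<in> \<theta>}" "y \<in> {a. (a, 0) \<in> \<theta>}" for x y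
    using congruenceD(4)[OF assms, of x 0 y 0] that by simp
  show "s * x \<in> {a. (a, 0) \<in> \<theta>}" if "x \<in> {a. (a, 0) \<in> \<theta>}" for s x
    using congruenceD(5)[OF assms congruenceD(1)[OF assms, of s], of x 0] that by simp
qed

lemma MaxCong_zero_class_prime:
  assumes "\<theta> \<in> MaxCong" and ab: "a * b \<in> cong_zero_class \<theta>"
  shows "a \<in> cong_zero_class \<theta> \<or> b \<in> cong_zero_class \<theta>"
proof (rule disjCI)
  assume b: "b \<notin> cong_zero_class \<theta>"
  have \<theta>: "congruence \<theta>"
    and max: "\<And>\<phi>. congruence \<phi> \<Longrightarrow> \<phi> \<noteq> UNIV \<Longrightarrow> \<theta> \<subseteq> \<phi> \<Longrightarrow> \<phi> = \<theta>"
    using assms(1) unfolding MaxCong_def by auto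
  note D = congruenceD[OF \<theta>]
  define \<phi> where "\<phi> = {(x, y). (x * b, y * b) \<in> \<theta>}"
  have "congruence \<phi>"
    unfolding congruence_def
  proof (intro conjI allI impI)
    show "equiv UNIV \<phi>"
    proof (rule equivI)
      show "refl \<phi>" by (simp add: refl_on_def \<phi>_def D(1))
      show "sym \<phi>" by (auto simp: \<phi>_def intro!: symI D(2))
      show "trans \<phi>" unfolding \<phi>_def by (rule transI) (use D(3) in blast)
    qed simp
    fix x y u v
    assume "(x, y) \<in> \<phi>" "(u, v) \<in> \<phi>"
    then have xy: "(x * b, y * b) \<in> \<theta>" and uv: "(u * b, v * b) \<in> \<theta>"
      by (auto simp: \<phi>_def)
    show "(x + u, y + v) \<in> \<phi>"
      using D(4)[OF xy uv] by (simp add: \<phi>_def distrib_right)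
    have "(x * b * u, y * b * u) \<in> \<theta>" "(y * (u * b), y * (v * b)) \<in> \<theta>"
      by (rule D(5)[OF xy D(1)[of u]], rule D(5)[OF D(1)[of y] uv])
    then have "(x * u * b, y * u * b) \<in> \<theta>" "(y * u * b, y * v * b) \<in> \<theta>"
      by (simp_all add: ac_simps)
    then show "(x * u, y * v) \<in> \<phi>"
      unfolding \<phi>_def using D(3) by blast
  qed
  moreover have "(1, 0) \<notin> \<phi>"
    using b by (simp add: \<phi>_def cong_zero_class_def)
  moreover have "\<theta> \<subseteq> \<phi>"
    unfolding \<phi>_def using D(5)[OF _ D(1)] by blast
  ultimately have "\<phi> = \<theta>"
    using max by blast
  moreover have "(a, 0) \<in> \<phi>"
    using ab by (simp add: \<phi>_def cong_zero_class_def)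
  ultimately show "a \<in> cong_zero_class \<theta>"
    by (simp add: cong_zero_class_def)
qed

lemma g_closure_iff:
  "x \<in> g_closure I \<longleftrightarrow> (\<forall>\<theta> \<in> MaxCong. I \<subseteq> cong_zero_class \<theta> \<longrightarrow> x \<in> cong_zero_class \<theta>)"
  by (auto simp: g_closure_def canonical_cong_def max_congs_over_def cong_zero_class_def)

lemma g_closure_in_Id_g: "g_closure I \<in> Id_g"
proof -
  have *: "semiring_ideal (cong_zero_class \<theta>)" if "\<theta> \<in> MaxCong" for \<theta> :: "'a rel"
    using that zero_class_ideal by (auto simp: MaxCong_def)
  have "semiring_ideal (g_closure I)"
    unfolding semiring_ideal_def
  proof (intro conjI allI ballI)
    have "(0 :: 'a) \<in> cong_zero_class \<theta>" if "\<theta> \<in> MaxCong" for \<theta> :: "'a rel"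
      using that congruenceD(1) by (auto simp: MaxCong_def cong_zero_class_def)
    then have "0 \<in> g_closure I"
      by (simp add: g_closure_iff)
    then show "g_closure I \<noteq> {}" by blast
  next
    fix x y assume "x \<in> g_closure I" "y \<in> g_closure I"
    then show "x + y \<in> g_closure I"
      using * by (auto simp: g_closure_iff semiring_ideal_def)
  next
    fix s x assume "x \<in> g_closure I"
    then show "s * x \<in> g_closure I"
      using * by (auto simp: g_closure_iff semiring_ideal_def)
  qed
  moreover have "g_closure (g_closure I) = g_closure I"
    by (auto simp: g_closure_iff subset_iff)
  ultimately show ?thesis
    by (simp add: Id_g_def)
qed

lemma principal_ideal_subset: "semiring_ideal I \<Longrightarrow> a \<in> I \<Longrightarrow> principal_ideal a \<subseteq> I"
  by (simp add: principal_ideal_def hull_minimal)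

lemma Spec_g_prime:
  assumes P: "P \<in> Spec_g"
  shows "a * b \<in> P \<longleftrightarrow> a \<in> P \<or> b \<in> P"
proof
  have id: "semiring_ideal P" and gP: "g_closure P = P"
    using P by (auto simp: Spec_g_def Id_g_def)
  show "a * b \<in> P" if "a \<in> P \<or> b \<in> P"
    using id that unfolding semiring_ideal_def by (metis mult.commute)
  assume ab: "a * b \<in> P"
  have "x * y \<in> P" if x: "x \<in> g_principal a" and y: "y \<in> g_principal b" for x y
  proof -
    have "x * y \<in> cong_zero_class \<theta>" if \<theta>: "\<theta> \<in> MaxCong" "P \<subseteq> cong_zero_class \<theta>" for \<theta>
    proof -
      have idz: "semiring_ideal (cong_zero_class \<theta>)"
        using \<theta> zero_class_ideal by (auto simp: MaxCong_def)
      have "a \<in> cong_zero_class \<theta> \<or> b \<in> cong_zero_class \<theta>"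
        using MaxCong_zero_class_prime ab \<theta> by blast
      then have "x \<in> cong_zero_class \<theta> \<or> y \<in> cong_zero_class \<theta>"
        using x y \<theta> principal_ideal_subset[OF idz]
        unfolding g_principal_def g_closure_iff by blast
      then show ?thesis
        using idz unfolding semiring_ideal_def by (metis mult.commute)
    qed
    then show ?thesis
      using gP g_closure_iff by blast
  qed
  then have "g_principal a * g_principal b \<subseteq> P"
    by (auto simp: set_times_def)
  then have "ideal_mult (g_principal a) (g_principal b) \<subseteq> P"
    by (simp add: ideal_mult_def hull_minimal id)
  then have "g_principal a \<subseteq> P \<or> g_principal b \<subseteq> P"
    using P g_closure_in_Id_g unfolding Spec_g_def g_principal_def by blast
  moreover have "c \<in> g_principal c" for c :: 'a
    using hull_subset[of "{c}" semiring_ideal]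
    by (auto simp: g_principal_def g_closure_iff principal_ideal_def)
  ultimately show "a \<in> P \<or> b \<in> P" by blast
qed

lemma canonical_cong_UNIV: 
  assumes "cong_zero_class (canonical_cong I) = UNIV"
  shows "canonical_cong I = UNIV"
proof -
  have False if "\<theta> \<in> max_congs_over I" for \<theta>
  proof -
    have \<theta>: "congruence \<theta>" "\<theta> \<noteq> UNIV"
      using that by (auto simp: max_congs_over_def MaxCong_def)
    have "(a, 0) \<in> \<theta>" for a
      using assms that by (auto simp: cong_zero_class_def canonical_cong_def)
    then have "(a, b) \<in> \<theta>" for a b
      using congruenceD(2,3)[OF \<theta>(1)] by blast
    then show False
      using \<theta>(2) by auto
  qed
  then show ?thesis
    by (auto simp: canonical_cong_def)
qed

lemma CSpec_g_prime:
  assumes "\<rho> \<in> CSpec_g"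
  shows "a * b \<in> cong_zero_class \<rho> \<longleftrightarrow> a \<in> cong_zero_class \<rho> \<or> b \<in> cong_zero_class \<rho>"
proof
  obtain I where "\<rho> = canonical_cong I"
    using assms by (auto simp: CSpec_g_def)
  then have "semiring_ideal (cong_zero_class \<rho>)"
    using g_closure_in_Id_g[of I] by (simp add: g_closure_def Id_g_def)
  then show "a * b \<in> cong_zero_class \<rho>" if "a \<in> cong_zero_class \<rho> \<or> b \<in> cong_zero_class \<rho>"
    using that unfolding semiring_ideal_def by (metis mult.commute)
qed (use assms in \<open>auto simp: CSpec_g_def cong_zero_class_def\<close>)

lemma CSpec_g_proper: "\<rho> \<in> CSpec_g \<Longrightarrow> cong_zero_class \<rho> \<noteq> UNIV"
  using canonical_cong_UNIV by (auto simp: CSpec_g_def)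

lemma Spec_g_proper: "P \<in> Spec_g \<Longrightarrow> P \<noteq> UNIV"
  by (simp add: Spec_g_def)

lemmas istopology_Spec_g =
  istopology_zariski[of Spec_g "\<lambda>P. P", OF Spec_g_prime]

lemmas istopology_CSpec_g =
  istopology_zariski[of CSpec_g cong_zero_class, OF CSpec_g_prime]

lemma
  shows topspace_Spec_g_space: "topspace Spec_g_space = Spec_g"
    and closedin_Spec_g_space:
      "closedin Spec_g_space C \<longleftrightarrow> (\<exists>A. C = {P \<in> Spec_g. A \<subseteq> P})"
  using closedin_zariski[OF Spec_g_space_def istopology_Spec_g Spec_g_proper] by blast+

lemma
  shows topspace_CSpec_g_space: "topspace CSpec_g_space = CSpec_g"
    and closedin_CSpec_g_space:
      "closedin CSpec_g_space C \<longleftrightarrow> (\<exists>A. C = {\<rho> \<in> CSpec_g. A \<subseteq> cong_zero_class \<rho>})"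
  using closedin_zariski[OF CSpec_g_space_def istopology_CSpec_g CSpec_g_proper] by blast+

end

theory Submission
  imports Defs
begin

text \<open>
  The zero class of a maximal congruence is a \<open>g\<close>-prime ideal, and \<open>g_closure A\<close> is by definition
  an intersection of such classes. Hence \<open>g_closure A\<close> is already the intersection of the
  \<open>g\<close>-primes above \<open>A\<close>, and primeness gives \<open>g_closure X \<inter> g_closure Y = g_closure (X * Y)\<close>.
  A finite \<open>g\<close>-join of principal closures is the closure of a nonempty finite set, so compact
  elements are closed under finite meets, and their compactness makes the open sets
  \<open>{P. \<not> X \<subseteq> P}\<close> with \<open>X\<close> finite quasi-compact. The generic point of an irreducible closed
  set is the intersection of its members. The two spectra are identified by taking zero classes.
\<close>

section \<open>Closures of arbitrary sets\<close>

lemma semiring_idealD: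
  assumes "semiring_ideal I"
  shows "0 \<in> I"
    and "x \<in> I \<Longrightarrow> y \<in> I \<Longrightarrow> x + y \<in> I"
    and "x \<in> I \<Longrightarrow> s * x \<in> I"
    and "x \<in> I \<Longrightarrow> x * s \<in> I"
proof -
  obtain z where "z \<in> I"
    using assms by (auto simp: semiring_ideal_def)
  then have "0 * z \<in> I"
    using assms unfolding semiring_ideal_def by blast
  then show "0 \<in> I" by simp
  show "x + y \<in> I" if "x \<in> I" "y \<in> I"
    using assms that by (auto simp: semiring_ideal_def)
  show *: "s * x \<in> I" if "x \<in> I"
    using assms that by (auto simp: semiring_ideal_def)
  show "x * s \<in> I" if "x \<in> I"
    using *[OF that] by (simp add: mult.commute)
qed

lemma ideal_g_closure: "semiring_ideal (g_closure A)"
  using g_closure_in_Id_g[of A] by (simp add: Id_g_def)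

lemma g_closure_superset: "A \<subseteq> g_closure A"
  by (auto simp: g_closure_iff)

lemma g_closure_minimal: "A \<subseteq> I \<Longrightarrow> I \<in> Id_g \<Longrightarrow> g_closure A \<subseteq> I"
  by (auto simp: Id_g_def g_closure_iff set_eq_iff subset_iff)

lemma g_closure_subset_iff: "g_closure A \<subseteq> g_closure B \<longleftrightarrow> A \<subseteq> g_closure B"
  by (rule iffI, rule subset_trans[OF g_closure_superset], assumption)
    (rule g_closure_minimal[OF _ g_closure_in_Id_g])

lemma g_closure_eqI: "A \<subseteq> g_closure B \<Longrightarrow> B \<subseteq> g_closure A \<Longrightarrow> g_closure A = g_closure B"
  by (simp add: g_closure_subset_iff subset_antisym)

lemma Id_gD: "I \<in> Id_g \<Longrightarrow> semiring_ideal I" "I \<in> Id_g \<Longrightarrow> g_closure I = I"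
  by (simp_all add: Id_g_def)

lemma UNIV_in_Id_g: "UNIV \<in> Id_g"
  using g_closure_superset[of UNIV] by (auto simp: Id_g_def semiring_ideal_def)

lemma Inter_in_Id_g:
  assumes "\<C> \<subseteq> Id_g"
  shows "\<Inter>\<C> \<in> Id_g"
proof -
  have "g_closure (\<Inter>\<C>) \<subseteq> I" if "I \<in> \<C>" for I
    using that assms by (intro g_closure_minimal) auto
  then have "g_closure (\<Inter>\<C>) = \<Inter>\<C>"
    using g_closure_superset by blast
  then show ?thesis
    using g_closure_in_Id_g by metis
qed

text \<open>The closure of any set is already an ideal, so it absorbs whatever \<open>a\<close>
  generates. This lets closures be computed from bare generating sets.\<close>

lemma g_principal_eq: "g_principal a = g_closure {a}"
  unfolding g_principal_def
proof (rule g_closure_eqI)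
  show "principal_ideal a \<subseteq> g_closure {a}"
    using g_closure_superset by (intro principal_ideal_subset ideal_g_closure) auto
  have "{a} \<subseteq> principal_ideal a"
    by (simp add: principal_ideal_def hull_subset)
  then show "{a} \<subseteq> g_closure (principal_ideal a)"
    using g_closure_superset by blast
qed

lemma g_principal_1: "g_principal 1 = UNIV"
proof -
  have "1 \<in> g_closure {1}"
    using g_closure_superset by blast
  then have "s * 1 \<in> g_closure {1}" for s
    by (rule semiring_idealD(3)[OF ideal_g_closure])
  then show ?thesis
    by (auto simp: g_principal_eq)
qed

text \<open>Closures contain \<open>0\<close>, so their elementwise sum contains both
  \<open>X\<close> and \<open>Y\<close>; joins thereby become unions of generators.\<close>

lemma g_join_closures: "g_join (g_closure X) (g_closure Y) = g_closure (X \<union> Y)"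
  unfolding g_join_def
proof (rule g_closure_eqI)
  have "g_closure X \<subseteq> g_closure (X \<union> Y)" "g_closure Y \<subseteq> g_closure (X \<union> Y)"
    using g_closure_superset[of "X \<union> Y"] by (auto simp: g_closure_subset_iff)
  then show "g_closure X + g_closure Y \<subseteq> g_closure (X \<union> Y)"
    by (auto simp: set_plus_def intro!: semiring_idealD(2)[OF ideal_g_closure])
  have "x + 0 \<in> g_closure X + g_closure Y" if "x \<in> X" for x
    using that g_closure_superset semiring_idealD(1)[OF ideal_g_closure] by (intro set_plus_intro) auto
  moreover have "0 + y \<in> g_closure X + g_closure Y" if "y \<in> Y" for y
    using that g_closure_superset semiring_idealD(1)[OF ideal_g_closure] by (intro set_plus_intro) auto
  ultimately have "X \<union> Y \<subseteq> g_closure X + g_closure Y"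
    by auto
  then show "X \<union> Y \<subseteq> g_closure (g_closure X + g_closure Y)"
    using g_closure_superset by blast
qed

text \<open>Nonemptiness of \<open>X\<close> reflects that the fold starts from a first principal
  closure. An enumeration of \<open>X\<close> as a list supplies the remaining joins.\<close>

lemma finite_g_joins_eq: "finite_g_joins = g_closure ` {X. finite X \<and> X \<noteq> {}}"
proof -
  have fold: "foldl g_join (g_closure X) (map g_principal as) = g_closure (X \<union> set as)"
    for X :: "'a set" and as
    by (induction as arbitrary: X) (simp_all add: g_principal_eq g_join_closures)
  have *: "\<exists>a as. X = insert a (set as)" if X: "finite X" "X \<noteq> {}" for X :: "'a set"
  proof -
    obtain xs where xs: "set xs = X"
      using finite_list[OF X(1)] by blast
    with X(2) show ?thesis
      by (cases xs) auto
  qed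
  have "{X :: 'a set. finite X \<and> X \<noteq> {}} = {insert a (set as) | a as. True}"
    by (intro subset_antisym subsetI) (use * in blast, auto)
  moreover have "foldl g_join (g_principal a) (map g_principal as) = g_closure (insert a (set as))"
    for a :: 'a and as
    using fold[of "{a}" as] by (simp add: g_principal_eq)
  ultimately show ?thesis
    unfolding finite_g_joins_def by auto
qed

text \<open>Zero classes of maximal congruences are prime, so one that contains \<open>X * Y\<close>
  contains \<open>X\<close> or \<open>Y\<close>. Conversely, each product lies in both closures
  because these are ideals.\<close>

lemma g_closure_Int: "g_closure X \<inter> g_closure Y = g_closure (X * Y)"
proof
  show "g_closure X \<inter> g_closure Y \<subseteq> g_closure (X * Y)"
  proof
    fix z assume z: "z \<in> g_closure X \<inter> g_closure Y"
    have "z \<in> cong_zero_class \<theta>" if \<theta>: "\<theta> \<in> MaxCong" "X * Y \<subseteq> cong_zero_class \<theta>" for \<theta>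
    proof -
      have "x \<in> cong_zero_class \<theta> \<or> y \<in> cong_zero_class \<theta>" if "x \<in> X" "y \<in> Y" for x y
        using MaxCong_zero_class_prime[OF \<theta>(1)] \<theta>(2) that by (auto intro: set_times_intro)
      then have "X \<subseteq> cong_zero_class \<theta> \<or> Y \<subseteq> cong_zero_class \<theta>"
        by blast
      then show ?thesis
        using z \<theta>(1) by (auto simp: g_closure_iff)
    qed
    then show "z \<in> g_closure (X * Y)"
      by (simp add: g_closure_iff)
  qed
  have "x * y \<in> g_closure X" "x * y \<in> g_closure Y" if "x \<in> X" "y \<in> Y" for x y
    using semiring_idealD(4)[OF ideal_g_closure, of x X y]
      semiring_idealD(3)[OF ideal_g_closure, of y Y x] that g_closure_superset by blast+
  then have "X * Y \<subseteq> g_closure X" "X * Y \<subseteq> g_closure Y"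
    by (auto simp: set_times_def)
  then show "g_closure (X * Y) \<subseteq> g_closure X \<inter> g_closure Y"
    by (simp add: g_closure_subset_iff)
qed

lemma finite_g_joins_Int:
  assumes "I \<in> finite_g_joins" "J \<in> finite_g_joins"
  shows "I \<inter> J \<in> finite_g_joins"
proof -
  obtain X Y where X: "finite X" "X \<noteq> {}" "I = g_closure X"
    and Y: "finite Y" "Y \<noteq> {}" "J = g_closure Y"
    using assms unfolding finite_g_joins_eq by blast
  have "X * Y \<noteq> {}"
    using X(2) Y(2) unfolding set_times_def by blast
  then show ?thesis
    unfolding X(3) Y(3) g_closure_Int finite_g_joins_eq
    using finite_set_times[OF X(1) Y(1)] by blast
qed

section \<open>Sums of ideals and joins of closures\<close>

lemma ideal_Sum_subset:
  assumes J: "semiring_ideal J" and "\<Union>\<I> \<subseteq> J"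
  shows "ideal_Sum \<I> \<subseteq> J"
proof -
  have "(\<Sum>I\<in>F. I) \<subseteq> J" if "finite F" "F \<subseteq> \<I>" for F
    using that
  proof (induction F rule: finite_induct)
    case empty
    then show ?case
      using semiring_idealD(1)[OF J] by simp
  next
    case (insert I F)
    moreover from insert have "I \<subseteq> J"
      using assms(2) by blast
    ultimately show ?case
      by (auto simp: set_plus_def intro!: semiring_idealD(2)[OF J])
  qed
  then show ?thesis
    by (auto simp: ideal_Sum_def)
qed

lemma Union_subset_ideal_Sum: "\<Union>\<I> \<subseteq> ideal_Sum \<I>"
proof
  fix x assume "x \<in> \<Union>\<I>"
  then obtain I where "I \<in> \<I>" "x \<in> I" by blast
  then have "x \<in> (\<Sum>I\<in>{I}. I)" "finite {I}" "{I} \<subseteq> \<I>"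
    by auto
  then show "x \<in> ideal_Sum \<I>"
    unfolding ideal_Sum_def by blast
qed

text \<open>Finite sums stay inside any ideal that contains the summands, so closing absorbs them.
  The joins of the frame can then be handled as closures of plain unions.\<close>

lemma g_closure_ideal_Sum: "g_closure (ideal_Sum \<I>) = g_closure (\<Union>\<I>)"
proof (rule g_closure_eqI)
  show "ideal_Sum \<I> \<subseteq> g_closure (\<Union>\<I>)"
    by (rule ideal_Sum_subset[OF ideal_g_closure g_closure_superset])
  show "\<Union>\<I> \<subseteq> g_closure (ideal_Sum \<I>)"
    using Union_subset_ideal_Sum g_closure_superset by blast
qed

lemma g_closure_Union_closures: "g_closure (\<Union>X\<in>\<X>. g_closure X) = g_closure (\<Union>\<X>)"
proof (rule g_closure_eqI)
  have "X \<subseteq> g_closure (\<Union>\<X>)" if "X \<in> \<X>" for X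
    using that g_closure_superset[of "\<Union>\<X>"] by blast
  then show "(\<Union>X\<in>\<X>. g_closure X) \<subseteq> g_closure (\<Union>\<X>)"
    by (simp add: UN_subset_iff g_closure_subset_iff)
  show "\<Union>\<X> \<subseteq> g_closure (\<Union>X\<in>\<X>. g_closure X)"
    using g_closure_superset by blast
qed

text \<open>For closed \<open>A\<close> this writes \<open>A\<close> as a join of principal
  closures; for general \<open>A\<close> it turns a set of generators into a cover of
  \<open>g_closure A\<close>.\<close>

lemma g_closure_UN_g_principal: "g_closure (\<Union>a\<in>A. g_principal a) = g_closure A"
  using g_closure_Union_closures[of "(\<lambda>a. {a}) ` A"] by (simp add: g_principal_eq)

section \<open>The frame of closed ideals\<close>

lemma Id_g_order_simps [simp]:
  "carrier Id_g_order = Id_g" "I \<sqsubseteq>\<^bsub>Id_g_order\<^esub> J \<longleftrightarrow> I \<subseteq> J"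
  by (simp_all add: Id_g_order_def)

context
  assumes H: "finite_type_g_closure TYPE('a::{comm_semiring_0, comm_monoid_mult})"
begin

lemma frame_Id_g: "frame (Id_g_order :: 'a set gorder)"
  using H by (simp add: finite_type_g_closure_def)

lemma Inf_Id_g: "\<I> \<subseteq> Id_g \<Longrightarrow> \<Sqinter>\<^bsub>Id_g_order\<^esub> \<I> = \<Inter>(\<I> :: 'a set set)"
  using H by (simp add: finite_type_g_closure_def)

lemma Sup_Id_g: "\<I> \<subseteq> Id_g \<Longrightarrow> \<Squnion>\<^bsub>Id_g_order\<^esub> \<I> = g_closure (\<Union>\<I> :: 'a set)"
  using H by (simp add: finite_type_g_closure_def g_closure_ideal_Sum)

lemma compact_Id_g: "compact_elements (Id_g_order :: 'a set gorder) = finite_g_joins"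
  using H by (simp add: finite_type_g_closure_def)

lemma top_Id_g: "\<top>\<^bsub>Id_g_order\<^esub> = (UNIV :: 'a set)"
proof -
  interpret complete_lattice "Id_g_order :: 'a set gorder"
    using frame_Id_g by (simp add: frame_def)
  show ?thesis
    using top_higher[of UNIV] UNIV_in_Id_g by auto
qed

lemma UNIV_compact: "(UNIV :: 'a set) \<in> finite_g_joins"
  using g_principal_1 by (auto simp: finite_g_joins_eq g_principal_eq image_iff intro!: exI[of _ "{1}"])

lemma coherent_Id_g: "coherent_frame (Id_g_order :: 'a set gorder)"
  unfolding coherent_frame_def compact_Id_g
proof (intro conjI ballI allI impI)
  show "\<top>\<^bsub>Id_g_order\<^esub> \<in> (finite_g_joins :: 'a set set)"
    by (simp add: top_Id_g UNIV_compact)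
next
  fix I :: "'a set" assume "I \<in> carrier Id_g_order"
  then have "g_closure (\<Union>a\<in>I. g_principal a) = I"
    by (simp add: g_closure_UN_g_principal Id_gD)
  then have "I = \<Squnion>\<^bsub>Id_g_order\<^esub> (g_principal ` I)"
    by (subst Sup_Id_g) (auto simp: g_principal_def g_closure_in_Id_g)
  moreover have "g_principal ` I \<subseteq> finite_g_joins"
    by (auto simp: finite_g_joins_eq g_principal_eq)
  ultimately show "\<exists>A \<subseteq> finite_g_joins. I = \<Squnion>\<^bsub>Id_g_order\<^esub> A"
    by blast
next
  fix F :: "'a set set" assume F: "F \<subseteq> finite_g_joins" "finite F"
  \<comment> \<open>The base case is the empty meet \<open>UNIV\<close>, which is compact as the
    closure of \<open>{1}\<close>.\<close>
  have "\<Inter>F \<in> finite_g_joins"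
    using F(2,1) by (induction F rule: finite_induct) (auto simp: UNIV_compact finite_g_joins_Int)
  moreover have "F \<subseteq> Id_g"
    using F(1) g_closure_in_Id_g by (auto simp: finite_g_joins_eq)
  ultimately show "\<Sqinter>\<^bsub>Id_g_order\<^esub> F \<in> finite_g_joins"
    by (simp add: Inf_Id_g)
qed (rule frame_Id_g)

text \<open>The principal closures of elements of \<open>A\<close> cover \<open>g_closure A\<close>.
  Compactness of \<open>g_closure X\<close> selects finitely many of them, and their generators form
  \<open>B\<close>.\<close>

lemma finite_g_closure_compact:
  fixes X A :: "'a set"
  assumes "finite X" "X \<subseteq> g_closure A"
  obtains B where "finite B" "B \<subseteq> A" "X \<subseteq> g_closure B"
proof (cases "X = {}")
  \<comment> \<open>Compact elements are listed as closures of nonempty finite sets, so the empty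
    \<open>X\<close> is handled separately by taking \<open>B\<close> empty.\<close>
  case True
  then show ?thesis using that[of "{}"] by simp
next
  case False
  have closed: "g_principal ` A' \<subseteq> Id_g" for A' :: "'a set"
    by (auto simp: g_principal_def g_closure_in_Id_g)
  have "g_closure X \<in> compact_elements (Id_g_order :: 'a set gorder)"
    using assms(1) False by (auto simp: compact_Id_g finite_g_joins_eq)
  moreover have "g_closure X \<subseteq> \<Squnion>\<^bsub>Id_g_order\<^esub> (g_principal ` A)"
    using assms(2) by (simp add: Sup_Id_g closed g_closure_UN_g_principal g_closure_subset_iff)
  ultimately obtain A0 where "A0 \<subseteq> g_principal ` A" "finite A0" "g_closure X \<subseteq> \<Squnion>\<^bsub>Id_g_order\<^esub> A0"
    using closed[of A] unfolding compact_elements_def by auto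
  moreover from this obtain B where "B \<subseteq> A" "finite B" "A0 = g_principal ` B"
    by (meson finite_subset_image)
  ultimately show ?thesis
    using that[of B]
    by (simp add: Sup_Id_g closed g_closure_UN_g_principal g_closure_subset_iff)
qed

end

section \<open>The spectrum of prime ideals\<close>

text \<open>Elements of \<open>A\<close> and \<open>B\<close> outside \<open>P\<close> would have a
  product outside \<open>P\<close> although it lies in \<open>ideal_mult A B\<close>. Testing
  primality on elements allows direct comparison with zero classes.\<close>

lemma Spec_g_iff:
  "P \<in> Spec_g \<longleftrightarrow> P \<in> Id_g \<and> P \<noteq> UNIV \<and> (\<forall>a b. a * b \<in> P \<longrightarrow> a \<in> P \<or> b \<in> P)"
proof (intro iffI conjI)
  assume *: "P \<in> Id_g \<and> P \<noteq> UNIV \<and> (\<forall>a b. a * b \<in> P \<longrightarrow> a \<in> P \<or> b \<in> P)"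
  have "A * B \<subseteq> ideal_mult A B" for A B :: "'a set"
    by (simp add: ideal_mult_def hull_subset)
  then have "A \<subseteq> P \<or> B \<subseteq> P" if "ideal_mult A B \<subseteq> P" for A B
    using * that set_times_intro[of _ A _ B] by blast
  then show "P \<in> Spec_g"
    using * by (auto simp: Spec_g_def)
qed (auto simp: Spec_g_prime Spec_g_def)

text \<open>The class is itself one of the sets intersected to form its closure, hence closed. If it
  were \<open>UNIV\<close>, all elements would be related through \<open>0\<close>, contradicting
  properness of the congruence.\<close>

lemma zero_class_in_Spec_g:
  assumes "\<theta> \<in> MaxCong"
  shows "cong_zero_class \<theta> \<in> Spec_g"
proof -
  have \<theta>: "congruence \<theta>" "\<theta> \<noteq> UNIV"
    using assms by (auto simp: MaxCong_def)
  have "g_closure (cong_zero_class \<theta>) = cong_zero_class \<theta>"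
    using assms g_closure_superset by (auto simp: g_closure_iff)
  then have "cong_zero_class \<theta> \<in> Id_g"
    using g_closure_in_Id_g by metis
  moreover have "cong_zero_class \<theta> \<noteq> UNIV"
  proof
    assume "cong_zero_class \<theta> = UNIV"
    then have "(a, 0) \<in> \<theta>" for a
      by (auto simp: cong_zero_class_def)
    then have "(a, b) \<in> \<theta>" for a b
      using congruenceD(2,3)[OF \<theta>(1)] by blast
    then show False
      using \<theta>(2) by auto
  qed
  ultimately show ?thesis
    using MaxCong_zero_class_prime[OF assms] by (auto simp: Spec_g_iff)
qed

text \<open>Closed primes above \<open>A\<close> contain the closure by minimality. Conversely, the
  maximal congruences over \<open>A\<close> supply enough of these primes to cut the intersection
  down to it. This is the analogue of the radical as an intersection of primes.\<close>

lemma g_closure_eq_Inter_Spec_g: "g_closure A = \<Inter>{P \<in> Spec_g. A \<subseteq> P}"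
proof
  show "g_closure A \<subseteq> \<Inter>{P \<in> Spec_g. A \<subseteq> P}"
    using g_closure_minimal by (auto simp: Spec_g_def)
  show "\<Inter>{P \<in> Spec_g. A \<subseteq> P} \<subseteq> g_closure A"
    unfolding g_closure_iff subset_iff[of "\<Inter>_"] by (auto dest: bspec zero_class_in_Spec_g)
qed

section \<open>Zariski open sets\<close>

definition Spec_g_open :: "'a::{comm_semiring_0, comm_monoid_mult} set \<Rightarrow> 'a set set" where
  "Spec_g_open A = {P \<in> Spec_g. \<not> A \<subseteq> P}"

lemma openin_Spec_g_space: "openin Spec_g_space U \<longleftrightarrow> (\<exists>A. U = Spec_g_open A)"
proof -
  have *: "U \<subseteq> Spec_g \<and> Spec_g - U = {P \<in> Spec_g. A \<subseteq> P} \<longleftrightarrow> U = Spec_g_open A" for A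
    by (auto simp: Spec_g_open_def)
  have "openin Spec_g_space U \<longleftrightarrow> (\<exists>A. U \<subseteq> Spec_g \<and> Spec_g - U = {P \<in> Spec_g. A \<subseteq> P})"
    by (simp add: openin_closedin_eq topspace_Spec_g_space closedin_Spec_g_space)
  then show ?thesis
    unfolding * .
qed

text \<open>Passing to complements, every prime above \<open>B\<close> must be above
  \<open>A\<close>, so \<open>A\<close> lies in the intersection of the primes above
  \<open>B\<close>. Questions about covers thus become questions about closures.\<close>

lemma Spec_g_open_subset_iff: "Spec_g_open A \<subseteq> Spec_g_open B \<longleftrightarrow> A \<subseteq> g_closure B"
  unfolding g_closure_eq_Inter_Spec_g Spec_g_open_def by blast

lemma Spec_g_open_Union: "Spec_g_open (\<Union>\<A>) = (\<Union>A\<in>\<A>. Spec_g_open A)"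
  by (auto simp: Spec_g_open_def)

lemma Spec_g_open_singletons: "Spec_g_open A = (\<Union>a\<in>A. Spec_g_open {a})"
  using Spec_g_open_Union[of "(\<lambda>a. {a}) ` A"] by simp

text \<open>Primes contain \<open>X * Y\<close> exactly when they contain one of the factors. Since
  products of finite sets are finite, the sets \<open>Spec_g_open X\<close> with \<open>X\<close>
  finite are closed under binary intersection.\<close>

lemma Spec_g_open_Int: "Spec_g_open X \<inter> Spec_g_open Y = Spec_g_open (X * Y)"
proof -
  have "X * Y \<subseteq> P \<longleftrightarrow> X \<subseteq> P \<or> Y \<subseteq> P" if "P \<in> Spec_g" for P
    unfolding set_times_def using Spec_g_prime[OF that] by blast
  then show ?thesis
    by (auto simp: Spec_g_open_def)
qed

lemma Spec_g_open_1: "Spec_g_open {1} = Spec_g"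
proof -
  have "1 \<notin> P" if "P \<in> Spec_g" for P :: "'a set"
  proof
    assume "1 \<in> P"
    then have "s * 1 \<in> P" for s
      using Spec_g_prime[OF that] by blast
    then show False
      using Spec_g_proper[OF that] by auto
  qed
  then show ?thesis
    by (auto simp: Spec_g_open_def)
qed

section \<open>Generic points and sobriety\<close>

lemma Spec_g_closure_of:
  assumes "P \<in> Spec_g"
  shows "Spec_g_space closure_of {P} = {Q \<in> Spec_g. P \<subseteq> Q}"
proof (rule closure_of_unique)
  show "closedin Spec_g_space {Q \<in> Spec_g. P \<subseteq> Q}"
    by (auto simp: closedin_Spec_g_space)
  show "{Q \<in> Spec_g. P \<subseteq> Q} \<subseteq> T" if "{P} \<subseteq> T" "closedin Spec_g_space T" for T
    using that by (auto simp: closedin_Spec_g_space)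
qed (use assms in simp)

lemma sober_Spec_g: "sober_space Spec_g_space"
  unfolding sober_space_def
proof (intro allI impI)
  fix C :: "'a set set" assume irr: "irreducible_closedin Spec_g_space C"
  obtain A where A: "C = {P \<in> Spec_g. A \<subseteq> P}"
    using irr by (auto simp: irreducible_closedin_def closedin_Spec_g_space)
  have "C \<noteq> {}"
    using irr by (simp add: irreducible_closedin_def)
  have "\<Inter>C \<in> Spec_g"
    unfolding Spec_g_iff
  proof (intro conjI allI impI)
    show "\<Inter>C \<in> Id_g"
      by (rule Inter_in_Id_g) (auto simp: A Spec_g_def)
    show "\<Inter>C \<noteq> UNIV"
      using \<open>C \<noteq> {}\<close> Spec_g_proper by (auto simp: A)
    fix a b assume ab: "a * b \<in> \<Inter>C"
    have C: "closedin Spec_g_space (C \<inter> {P. c \<in> P})" for c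
      unfolding closedin_Spec_g_space A by (intro exI[of _ "insert c A"]) auto
    \<comment> \<open>Every prime in \<open>C\<close> contains \<open>a * b\<close>, hence
      \<open>a\<close> or \<open>b\<close>; irreducibility then forces all of them to contain one
      and the same factor.\<close>
    have "C = (C \<inter> {P. a \<in> P}) \<union> (C \<inter> {P. b \<in> P})"
      using ab Spec_g_prime by (fastforce simp: A)
    then have "C = C \<inter> {P. a \<in> P} \<or> C = C \<inter> {P. b \<in> P}"
      using irr C unfolding irreducible_closedin_def by blast
    then show "a \<in> \<Inter>C \<or> b \<in> \<Inter>C"
      by blast
  qed
  moreover have "{Q \<in> Spec_g. \<Inter>C \<subseteq> Q} = C"
    by (auto simp: A)
  \<comment> \<open>Uniqueness holds because a point whose closure is \<open>C\<close> is the least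
    member of \<open>C\<close>, hence equals \<open>\<Inter>C\<close>.\<close>
  ultimately show "\<exists>!P. P \<in> topspace Spec_g_space \<and> Spec_g_space closure_of {P} = C"
    unfolding topspace_Spec_g_space
    by (intro ex1I[of _ "\<Inter>C"]) (auto simp: Spec_g_closure_of)
qed

section \<open>Quasi-compactness and spectrality\<close>

lemma compactin_Spec_g_open:
  fixes X :: "'a::{comm_semiring_0, comm_monoid_mult} set"
  assumes H: "finite_type_g_closure TYPE('a)" and "finite X"
  shows "compactin Spec_g_space (Spec_g_open X)"
  unfolding compactin_def
proof (intro conjI allI impI)
  show "Spec_g_open X \<subseteq> topspace Spec_g_space"
    by (auto simp: topspace_Spec_g_space Spec_g_open_def)
  fix \<U> :: "'a set set set"
  assume \<U>: "Ball \<U> (openin Spec_g_space) \<and> Spec_g_open X \<subseteq> \<Union>\<U>"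
  \<comment> \<open>The cover is refined to the sets \<open>Spec_g_open {a}\<close> that fit inside
    one of its members, so that a subcover becomes a choice of generators from
    \<open>A\<close>.\<close>
  define A where "A = {a. \<exists>U\<in>\<U>. Spec_g_open {a} \<subseteq> U}"
  have "Spec_g_open X \<subseteq> Spec_g_open A"
  proof
    fix P assume "P \<in> Spec_g_open X"
    then obtain U where U: "U \<in> \<U>" "P \<in> U"
      using \<U> by blast
    moreover obtain B where B: "U = Spec_g_open B"
      using \<U> U(1) by (auto simp: openin_Spec_g_space)
    ultimately obtain b where "b \<in> B" "P \<in> Spec_g_open {b}"
      using Spec_g_open_singletons[of B] by blast
    moreover from this have "b \<in> A"
      using U(1) B Spec_g_open_singletons[of B] unfolding A_def by blast
    ultimately show "P \<in> Spec_g_open A"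
      using Spec_g_open_singletons[of A] by blast
  qed
  \<comment> \<open>Read as \<open>X \<subseteq> g_closure A\<close>, the covering condition needs
    only finitely many generators, by compactness in the frame.\<close>
  then obtain B where B: "finite B" "B \<subseteq> A" "Spec_g_open X \<subseteq> Spec_g_open B"
    using finite_g_closure_compact[OF H \<open>finite X\<close>] unfolding Spec_g_open_subset_iff by blast
  have "\<forall>b\<in>B. \<exists>U. U \<in> \<U> \<and> Spec_g_open {b} \<subseteq> U"
    using B(2) unfolding A_def by blast
  from bchoice[OF this] obtain f where f: "\<And>b. b \<in> B \<Longrightarrow> f b \<in> \<U> \<and> Spec_g_open {b} \<subseteq> f b"
    by blast
  note B(3)
  also have "Spec_g_open B = (\<Union>b\<in>B. Spec_g_open {b})"
    by (rule Spec_g_open_singletons)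
  also have "\<dots> \<subseteq> \<Union>(f ` B)"
    using f by blast
  finally show "\<exists>\<F>. finite \<F> \<and> \<F> \<subseteq> \<U> \<and> Spec_g_open X \<subseteq> \<Union>\<F>"
    using B(1) f by (intro exI[of _ "f ` B"]) auto
qed

lemma spectral_Spec_g:
  assumes "finite_type_g_closure TYPE('a::{comm_semiring_0, comm_monoid_mult})"
  shows "spectral_space (Spec_g_space :: 'a set topology)"
  unfolding spectral_space_def
proof (intro conjI exI[of _ "Spec_g_open ` {X :: 'a set. finite X}"])
  let ?B = "Spec_g_open ` {X :: 'a set. finite X}"
  show "compact_space (Spec_g_space :: 'a set topology)"
    using compactin_Spec_g_open[OF assms, of "{1}"]
    by (simp add: compact_space_def Spec_g_open_1 topspace_Spec_g_space)
  show "sober_space (Spec_g_space :: 'a set topology)"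
    by (rule sober_Spec_g)
  show "\<forall>U\<in>?B. openin Spec_g_space U \<and> compactin Spec_g_space U"
    using compactin_Spec_g_open[OF assms] by (auto simp: openin_Spec_g_space)
  show "openin Spec_g_space = arbitrary union_of (\<lambda>U. U \<in> ?B)"
  proof (rule ext)
    fix U :: "'a set set"
    show "openin Spec_g_space U = (arbitrary union_of (\<lambda>U. U \<in> ?B)) U"
    proof
      assume "openin Spec_g_space U"
      then obtain A where "U = (\<Union>a\<in>A. Spec_g_open {a})"
        by (metis openin_Spec_g_space Spec_g_open_singletons)
      then show "(arbitrary union_of (\<lambda>U. U \<in> ?B)) U"
        by (auto simp: union_of_def arbitrary_def intro!: exI[of _ "(\<lambda>a. Spec_g_open {a}) ` A"])
    next
      assume "(arbitrary union_of (\<lambda>U. U \<in> ?B)) U"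
      then obtain \<U> where "\<U> \<subseteq> ?B" "U = \<Union>\<U>"
        by (auto simp: union_of_def)
      moreover from this have "openin Spec_g_space V" if "V \<in> \<U>" for V
        using that unfolding openin_Spec_g_space by blast
      ultimately show "openin Spec_g_space U"
        by (auto intro: openin_Union)
    qed
  qed
  show "\<forall>F\<subseteq>?B. finite F \<longrightarrow> topspace Spec_g_space \<inter> \<Inter>F \<in> ?B"
  proof (intro allI impI)
    fix F assume "F \<subseteq> ?B" "finite F"
    from this(2,1) show "topspace Spec_g_space \<inter> \<Inter>F \<in> ?B"
    proof (induction F rule: finite_induct)
      case empty
      \<comment> \<open>The empty intersection is the whole space, which belongs to the basis as
        \<open>Spec_g_open {1}\<close>.\<close>
      show ?case
        using Spec_g_open_1 by (auto simp: topspace_Spec_g_space image_iff intro!: exI[of _ "{1}"])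
    next
      case (insert U F)
      then obtain X Y where XY: "finite X" "finite Y" "U = Spec_g_open X"
          "topspace Spec_g_space \<inter> \<Inter>F = Spec_g_open Y"
        by auto
      have "topspace Spec_g_space \<inter> \<Inter>(insert U F) = U \<inter> (topspace Spec_g_space \<inter> \<Inter>F)"
        by auto
      also have "\<dots> = Spec_g_open (X * Y)"
        unfolding XY(3,4) by (rule Spec_g_open_Int)
      finally show ?case
        using XY(1,2) by (simp add: finite_set_times)
    qed
  qed
qed

section \<open>The spectrum of prime congruences\<close>

text \<open>This is \<open>g\<close>-closedness unfolded; it makes \<open>canonical_cong\<close>
  injective on \<open>Id_g\<close>.\<close>

lemma zero_class_canonical_cong: "I \<in> Id_g \<Longrightarrow> cong_zero_class (canonical_cong I) = I"
  by (simp add: Id_g_def flip: g_closure_def)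

text \<open>For closed \<open>I\<close>, the pair \<open>(a, 0)\<close> lies in
  \<open>canonical_cong I\<close> exactly when \<open>a \<in> I\<close>, so the two notions of
  primality agree.\<close>

lemma CSpec_g_eq: "CSpec_g = canonical_cong ` Spec_g"
proof -
  have "canonical_cong I \<in> CSpec_g \<longleftrightarrow> I \<in> Spec_g" if I: "I \<in> Id_g" for I :: "'a set"
  proof -
    have "(a, 0) \<in> canonical_cong I \<longleftrightarrow> a \<in> I" for a
      using zero_class_canonical_cong[OF I] by (auto simp: cong_zero_class_def)
    \<comment> \<open>If the zero class is everything, no maximal congruence lies over
      \<open>I\<close>, and the empty intersection is total.\<close>
    moreover have "canonical_cong I = UNIV \<longleftrightarrow> I = UNIV"
      using zero_class_canonical_cong[OF I] canonical_cong_UNIV[of I]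
      by (auto simp: cong_zero_class_def)
    ultimately show ?thesis
      using I by (auto simp: CSpec_g_def Spec_g_iff)
  qed
  moreover have "CSpec_g \<subseteq> canonical_cong ` Id_g" "Spec_g \<subseteq> Id_g"
    by (auto simp: CSpec_g_def Spec_g_def)
  ultimately show ?thesis
    by blast
qed

text \<open>\<open>cong_zero_class\<close> and \<open>canonical_cong\<close> are mutually inverse
  between the spectra, and the closed set given by \<open>A\<close> on one side corresponds to the
  closed set given by the same \<open>A\<close> on the other.\<close>

lemma CSpec_g_homeomorphic_Spec_g:
  "(CSpec_g_space :: 'a::{comm_semiring_0, comm_monoid_mult} rel topology)
     homeomorphic_space (Spec_g_space :: 'a set topology)"
proof -
  have zero: "cong_zero_class (canonical_cong P) = P" if "P \<in> Spec_g" for P :: "'a set"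
    using that by (intro zero_class_canonical_cong) (simp add: Spec_g_def)
  have Spec: "canonical_cong P \<in> CSpec_g" if "P \<in> Spec_g" for P :: "'a set"
    using that by (simp add: CSpec_g_eq)
  have CSpec: "cong_zero_class \<rho> \<in> Spec_g \<and> canonical_cong (cong_zero_class \<rho>) = \<rho>"
    if "\<rho> \<in> CSpec_g" for \<rho> :: "'a rel"
    using that zero by (auto simp: CSpec_g_eq)
  have "continuous_map CSpec_g_space Spec_g_space (cong_zero_class :: 'a rel \<Rightarrow> _)"
    unfolding continuous_map_closedin topspace_CSpec_g_space topspace_Spec_g_space
      closedin_CSpec_g_space closedin_Spec_g_space
  proof (intro conjI allI impI)
    show "cong_zero_class \<in> CSpec_g \<rightarrow> (Spec_g :: 'a set set)"
      using CSpec by simp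
    fix C :: "'a set set" assume "\<exists>A. C = {P \<in> Spec_g. A \<subseteq> P}"
    then obtain A where "C = {P \<in> Spec_g. A \<subseteq> P}" ..
    then have "{\<rho> \<in> CSpec_g. cong_zero_class \<rho> \<in> C} = {\<rho> \<in> CSpec_g. A \<subseteq> cong_zero_class \<rho>}"
      using CSpec by auto
    then show "\<exists>A. {\<rho> \<in> CSpec_g. cong_zero_class \<rho> \<in> C} = {\<rho> \<in> CSpec_g. A \<subseteq> cong_zero_class \<rho>}" ..
  qed
  moreover have "continuous_map Spec_g_space CSpec_g_space (canonical_cong :: 'a set \<Rightarrow> _)"
    unfolding continuous_map_closedin topspace_CSpec_g_space topspace_Spec_g_space
      closedin_CSpec_g_space closedin_Spec_g_space
  proof (intro conjI allI impI)
    show "canonical_cong \<in> Spec_g \<rightarrow> (CSpec_g :: 'a rel set)"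
      using Spec by simp
    fix C :: "'a rel set" assume "\<exists>A. C = {\<rho> \<in> CSpec_g. A \<subseteq> cong_zero_class \<rho>}"
    then obtain A where "C = {\<rho> \<in> CSpec_g. A \<subseteq> cong_zero_class \<rho>}" ..
    then have "{P \<in> Spec_g. canonical_cong P \<in> C} = {P \<in> Spec_g. A \<subseteq> P}"
      using Spec zero by auto
    then show "\<exists>A. {P \<in> Spec_g. canonical_cong P \<in> C} = {P \<in> Spec_g. A \<subseteq> P}" ..
  qed
  ultimately have "homeomorphic_maps CSpec_g_space Spec_g_space
      (cong_zero_class :: 'a rel \<Rightarrow> _) canonical_cong"
    by (simp add: homeomorphic_maps_def topspace_CSpec_g_space topspace_Spec_g_space zero CSpec)
  then show ?thesis
    unfolding homeomorphic_space_def by blast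
qed

theorem theorem3:
  assumes "finite_type_g_closure TYPE('a::{comm_semiring_0, comm_monoid_mult})"
  shows "coherent_frame (Id_g_order :: 'a set gorder) \<and>
         spectral_space (Spec_g_space :: 'a set topology) \<and>
         (CSpec_g_space :: 'a rel topology) homeomorphic_space (Spec_g_space :: 'a set topology)"
  using coherent_Id_g[OF assms] spectral_Spec_g[OF assms] CSpec_g_homeomorphic_Spec_g by blast

end
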